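(* Let $r,l\geq 1$ and $m,k\geq 0$ be integers, let $\boldsymbol{\omega}=(\omega_1,\dots,\omega_r)\in\mathbb{C}^r$ and $\boldsymbol{\alpha}=(\alpha_1,\dots,\alpha_l)\in\mathbb{C}^l$ with $\mathrm{Re}(\omega_i)>0$, $\mathrm{Re}(\alpha_j)>0$ for all $i,j$, and let $a\in\mathbb{C}$ with $\mathrm{Re}(a)>0$. Then, as $w\to\infty$, \[{}_mP_{r+l,k}\big(w+a;(\boldsymbol{\omega},\boldsymbol{\alpha})\big)=\sum_{N=-l}^{r+k} a_{l,N}(a;\boldsymbol{\alpha})\,{}_mP_{r,k-N}(w;\boldsymbol{\omega})+O\!\left(\frac{(\log w)^{m-1}}{w}\right).\]
   Context: For $\boldsymbol{\omega}\in\mathbb{C}^r$ with $\mathrm{Re}(\omega_i)>0$, put $f_{\boldsymbol{\omega}}(t)=\prod_{i=1}^r(1-e^{-\omega_i t})^{-1}$. For $\boldsymbol{\alpha}\in\mathbb{C}^l$ with $\mathrm{Re}(\alpha_j)>0$ and $a\in\mathbb{C}$, the multiple Bernoulli polynomials $a_{l,N}(a;\boldsymbol{\alpha})$ are defined by the Laurent expansion $\frac{e^{-at}}{\prod_{j=1}^l(1-e^{-\alpha_j t})}=\sum_{N=-l}^{\infty}a_{l,N}(a;\boldsymbol{\alpha})t^N$ at $t=0$. For integers $\mu\geq 0$ define polynomials ${}_\mu Q_0(x)$ by the Taylor expansion at $s=0$ of the function (holomorphic there) $\frac{e^{sx}}{\Gamma(s)(e^{2\pi i s}-1)}=\sum_{\mu=0}^\infty\frac{{}_\mu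 Q_0(x)}{\mu!}s^\mu$. Let $I(\lambda,\infty)$ be the path consisting of the ray from $+\infty$ to $\lambda$ (with $\arg t=0$), the circle $|t|=\lambda$ traversed once in the positive sense, and the ray from $\lambda$ to $+\infty$ (with $\arg t=2\pi$), where $0<\lambda<\min_i|2\pi/\omega_i|$; $\log t$ and powers of $t$ are taken with this choice of argument. For every integer $k\in\mathbb{Z}$ (including negative $k$), integer $m\geq0$, and $w$ with $\mathrm{Re}(w)>0$, the balanced hypermultiple gamma function of BM-type is ${}_mP_{r,k}(w;\boldsymbol{\omega})=\int_{I(\lambda,\infty)}f_{\boldsymbol{\omega}}(t)e^{-wt}t^{-k-1}\,{}_mQ_0(\log t)\,dt$. (For $k\geq0$ this equals $\sum_{\mu=0}^m c^m_{m-\mu,k}\,\frac{\partial^\mu}{\partial s^\mu}\zeta_r(s,w;\boldsymbol{\omega})\big|_{s=-k}$, where $\zeta_r(s,w;\boldsymbol{\omega})=\sum_{n_1,\dots,n_r\geq0}(n_1\omega_1+\cdots+n_r\omega_r+w)^{-s}$ is the Barnes multiple zeta function continued meromorphically in $s$, $c^m_{\mu,k}=\frac{(-1)^k}{k!}\frac{m!}{(m-\mu)!}H_k(\mu)$, $H_k(\mu)=\sum_{0<j_1\leq\cdots\leq j_\mu\leq k}(j_1\cdots j_\mu)^{-1}$ with $H_k(0)=1$ and $H_0(\mu)=0$ for $\mu\geq1$.) Here $w\to\infty$ along the positive reals. *)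

theory Defs
  imports "HOL-Complex_Analysis.Complex_Analysis" "HOL-Library.Landau_Symbols"
begin

text \<open>Vectors of parameters are lists of complex numbers, so that the concatenation of two
  parameter vectors is list append and the rank is the length of the list.\<close>

definition barnes_kernel :: "complex list \<Rightarrow> complex \<Rightarrow> complex" where
  "barnes_kernel \<omega> t = (\<Prod>z\<leftarrow>\<omega>. inverse (1 - exp (- z * t)))"

definition multi_bernoulli :: "int \<Rightarrow> complex \<Rightarrow> complex list \<Rightarrow> complex" where
  "multi_bernoulli N a \<alpha> =
     fls_nth (laurent_expansion (\<lambda>t. exp (- a * t) / (\<Prod>z\<leftarrow>\<alpha>. 1 - exp (- z * t))) 0) N"

text \<open>The singularity of the generating function at \<open>s = 0\<close> is removable, but the library
  conventions \<open>Gamma 0 = 0\<close> and \<open>x / 0 = 0\<close> give it the wrong value there; hence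
  \<^const>\<open>remove_sings\<close> before taking the Taylor expansion.\<close>

definition Q0 :: "nat \<Rightarrow> complex \<Rightarrow> complex" where
  "Q0 \<mu> x = fact \<mu> *
     fps_nth (fps_expansion
       (remove_sings (\<lambda>s. exp (s * x) / (Gamma s * (exp (2 * of_real pi * \<i> * s) - 1)))) 0) \<mu>"

text \<open>The integral of \<open>G (log t)\<close> along the path \<open>I(\<rho>,\<infinity>)\<close>: from \<open>+\<infinity>\<close> to \<open>\<rho>\<close>, once
  counterclockwise around the circle of radius \<open>\<rho>\<close>, and back to \<open>+\<infinity>\<close>. The integrand is a function
  of \<open>log t\<close> rather than of \<open>t\<close>, because \<open>log t = ln \<bar>t\<bar> + \<i> arg t\<close>
  is continued along the path, with \<open>arg t\<close> running from \<open>0\<close> on the incoming ray to \<open>2\<pi>\<close> on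
  the outgoing one.\<close>

definition hankel_integral :: "real \<Rightarrow> (complex \<Rightarrow> complex) \<Rightarrow> complex" where
  "hankel_integral \<rho> G =
     - integral {\<rho>..} (\<lambda>x. G (of_real (ln x)))
     + integral {0..2 * pi}
         (\<lambda>\<theta>. G (of_real (ln \<rho>) + \<i> * of_real \<theta>) * (\<i> * of_real \<rho> * cis \<theta>))
     + integral {\<rho>..} (\<lambda>x. G (of_real (ln x) + 2 * of_real pi * \<i>))"

definition admissible_radius :: "complex list \<Rightarrow> real \<Rightarrow> bool" where
  "admissible_radius \<omega> \<rho> \<longleftrightarrow> 0 < \<rho> \<and> (\<forall>z\<in>set \<omega>. \<rho> < cmod (2 * of_real pi / z))"

text \<open>The balanced hypermultiple gamma function of BM-type. Its value is the same for every admissible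
  radius \<open>\<rho>\<close> (Cauchy); the radius is kept as an explicit argument. Here \<open>u\<close> is \<open>log t\<close>.\<close>

definition hyper_gamma_BM ::
    "real \<Rightarrow> nat \<Rightarrow> int \<Rightarrow> complex \<Rightarrow> complex list \<Rightarrow> complex" where
  "hyper_gamma_BM \<rho> m k w \<omega> =
     hankel_integral \<rho> (\<lambda>u. let t = exp u in
       barnes_kernel \<omega> t * exp (- w * t) * t powi (- k - 1) * Q0 m u)"

end

theory Submission
  imports Defs "HOL-Real_Asymp.Real_Asymp"
begin

text \<open>Both sides are Hankel integrals of the same type, so their difference is the Hankel integral of
  \<open>g(t) e\<^sup>-\<^sup>w\<^sup>t Q(log t)\<close>, where \<open>Q\<close> is a polynomial of degree at most \<open>m\<close> and
  \<open>g(t) = f\<^sub>\<omega>(t) t\<^sup>-\<^sup>k\<^sup>-\<^sup>1\<close> times the remainder of the Laurent series defining the Bernoulli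
  polynomials. The truncation at \<open>N = r + k\<close> is exactly what makes \<open>g\<close> bounded near \<open>0\<close>, so the circle
  can be shrunk to the origin. What remains is
  \<open>\<integral> g(x) e\<^sup>-\<^sup>w\<^sup>x (Q(log x + 2\<pi>\<i>) - Q(log x)) dx\<close> over \<open>x > 0\<close>. The difference of \<open>Q\<close> has degree at most
  \<open>m - 1\<close>, and vanishes for \<open>m = 0\<close>; the substitution \<open>y = w x\<close> gives the bound.\<close>

subsection \<open>Power series at the origin\<close>

text \<open>The zero of \<open>1 / Gamma\<close> at the origin cancels the simple zero of
  \<open>exp (2 * pi * \<i> * s) - 1\<close>, so the quotient is a power series \<open>B\<close>
  that does not involve \<open>x\<close>. The Cauchy product of \<open>B\<close> with the
  exponential series then shows the \<open>m\<close>-th Taylor coefficient as a polynomial in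
  \<open>x\<close>.\<close>

lemma Q0_eq_poly: "\<exists>p. degree p \<le> m \<and> (\<forall>x. Q0 m x = poly p x)"
proof -
  define A where "A = fps_expansion (rGamma :: complex \<Rightarrow> complex) 0"
  define E where "E = fps_exp (2 * of_real pi * \<i>) - 1"
  define L where "L = fps_to_fls A * inverse (fps_to_fls E)"
  have A: "rGamma has_fps_expansion A"
    unfolding A_def by (intro analytic_at_imp_has_fps_expansion_0 analytic_intros)
  have A0: "fps_nth A 0 = 0"
    using A by (auto simp: has_fps_expansion_to_laurent)
  have E: "(\<lambda>s. exp (2 * of_real pi * \<i> * s) - 1) has_fps_expansion E"
    unfolding E_def by (intro fps_expansion_intros)
  have E1: "fps_nth E 0 = 0" "fps_nth E 1 \<noteq> 0"
    by (auto simp: E_def)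
  have "subdegree E = 1"
    using E1 by (intro subdegreeI) auto
  have "E \<noteq> 0"
    using E1 by auto
  have L: "(\<lambda>s. rGamma s * inverse (exp (2 * of_real pi * \<i> * s) - 1)) has_laurent_expansion L"
    unfolding L_def using A E by (intro laurent_expansion_intros has_laurent_expansion_fps)
  have "fls_subdegree L \<ge> 0"
  proof (cases "A = 0")
    case False
    hence "subdegree A \<ge> 1"
      using A0 by (intro subdegree_geI) auto
    thus ?thesis
      using False \<open>E \<noteq> 0\<close> \<open>subdegree E = 1\<close>
      by (simp add: L_def fls_subdegree_fls_to_fps)
  qed (auto simp: L_def)
  then obtain B where B: "L = fps_to_fls B"
    by (metis fls_regpart_to_fls_trivial)
  have "Q0 m x = (\<Sum>i\<le>m. (fact m / fact i * fps_nth B (m - i)) * x ^ i)" for x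
  proof -
    define f where "f = (\<lambda>s. exp (s * x) / (Gamma s * (exp (2 * of_real pi * \<i> * s) - 1)))"
    define F where "F = fps_exp x * B"
    have "(\<lambda>s. exp (x * s) * (rGamma s * inverse (exp (2 * of_real pi * \<i> * s) - 1)))
            has_laurent_expansion fps_to_fls (fps_exp x) * L"
      by (intro laurent_expansion_intros has_laurent_expansion_fps fps_expansion_intros L)
    \<comment> \<open>The two functions agree at every \<open>s\<close>, poles of
      \<open>Gamma\<close> included: the conventions \<open>Gamma s = 0\<close> and
      \<open>inverse 0 = 0\<close> match \<open>rGamma s = 0\<close> there.\<close>
    also have "(\<lambda>s. exp (x * s) * (rGamma s * inverse (exp (2 * of_real pi * \<i> * s) - 1))) = f"
      by (auto simp: f_def rGamma_inverse_Gamma field_simps)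
    also have "fps_to_fls (fps_exp x) * L = fps_to_fls F"
      by (simp add: B F_def fls_times_fps_to_fls)
    finally have f: "f has_laurent_expansion fps_to_fls F" .
    hence "f \<midarrow>0\<rightarrow> fls_nth (fps_to_fls F) 0"
      by (rule has_laurent_expansion_imp_tendsto_0) (rule fls_subdegree_fls_to_fps_gt0)
    hence "remove_sings f 0 = fps_nth F 0"
      by (auto intro: remove_sings_eqI)
    \<comment> \<open>A Laurent expansion sees only a punctured neighbourhood, where
      \<open>remove_sings f\<close> equals \<open>f\<close>. Together with the value at 0 just
      found, it becomes a Taylor expansion.\<close>
    moreover have "isolated_singularity_at f 0"
      using has_laurent_expansion_isolated_0[OF f] .
    hence "remove_sings f has_laurent_expansion fps_to_fls F"
      using f has_laurent_expansion_cong[OF eventually_remove_sings_eq_at refl] by blast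
    ultimately have "remove_sings f has_fps_expansion F"
      by (simp add: has_fps_expansion_to_laurent)
    hence "fps_expansion (remove_sings f) 0 = F"
      by (rule fps_expansion_eqI)
    hence "Q0 m x = fact m * fps_nth F m"
      by (simp add: Q0_def f_def)
    also have "\<dots> = (\<Sum>i\<le>m. (fact m / fact i * fps_nth B (m - i)) * x ^ i)"
      unfolding F_def fps_mult_nth sum_distrib_left atLeast0AtMost
      by (intro sum.cong) auto
    finally show ?thesis .
  qed
  hence "Q0 m x = poly (\<Sum>i\<le>m. monom (fact m / fact i * fps_nth B (m - i)) i) x" for x
    by (simp add: poly_sum poly_monom)
  moreover have "degree (\<Sum>i\<le>m. monom (fact m / fact i * fps_nth B (m - i)) i) \<le> m"
    by (intro degree_sum_le) (auto intro: order.trans[OF degree_monom_le])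
  ultimately show ?thesis
    by blast
qed

lemma barnes_kernel_append: "barnes_kernel (xs @ ys) t = barnes_kernel xs t * barnes_kernel ys t"
  by (simp add: barnes_kernel_def)

text \<open>Each factor \<open>1 - exp (- z * t)\<close> with \<open>z\<close> nonzero has a simple
  zero at the origin, so every entry adds exactly one to the pole order. The conclusion
  \<open>F \<noteq> 0\<close> is recorded because subdegrees add up only for nonzero series.\<close>

lemma has_laurent_expansion_barnes_kernel:
  assumes "0 \<notin> set \<omega>"
  obtains F where "barnes_kernel \<omega> has_laurent_expansion F" "fls_subdegree F = - int (length \<omega>)"
    "F \<noteq> 0"
proof -
  have "\<exists>F. barnes_kernel \<omega> has_laurent_expansion F \<and> fls_subdegree F = - int (length \<omega>) \<and> F \<noteq> 0"
    using assms
  proof (induction \<omega>)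
    case Nil
    show ?case
      by (rule exI[of _ 1]) (auto simp: barnes_kernel_def)
  next
    case (Cons z \<omega>)
    then obtain F where F: "barnes_kernel \<omega> has_laurent_expansion F"
      "fls_subdegree F = - int (length \<omega>)" "F \<noteq> 0"
      by auto
    define E where "E = 1 - fps_exp (- z)"
    have "fps_nth E 0 = 0" "fps_nth E 1 \<noteq> 0"
      using Cons.prems by (auto simp: E_def)
    hence E: "subdegree E = 1" "E \<noteq> 0"
      by (auto intro: subdegreeI)
    have "(\<lambda>t. inverse (1 - exp (- z * t)) * barnes_kernel \<omega> t) has_laurent_expansion
            inverse (fps_to_fls E) * F"
      unfolding E_def
      by (intro laurent_expansion_intros has_laurent_expansion_fps fps_expansion_intros F)
    also have "(\<lambda>t. inverse (1 - exp (- z * t)) * barnes_kernel \<omega> t) = barnes_kernel (z # \<omega>)"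
      by (simp add: barnes_kernel_def fun_eq_iff)
    finally show ?case
      using E F by (intro exI[of _ "inverse (fps_to_fls E) * F"]) (simp add: fls_subdegree_fls_to_fps)
  qed
  thus ?thesis
    using that by blast
qed

text \<open>Rewrites the quotient of the definition as a product with \<open>barnes_kernel\<close>.
  The subdegree shows that no coefficient is lost by starting the sum over \<open>N\<close> at minus
  the length of \<alpha>.\<close>

lemma multi_bernoulli_expansion:
  assumes "0 \<notin> set \<alpha>"
  obtains L where "(\<lambda>t. exp (- a * t) * barnes_kernel \<alpha> t) has_laurent_expansion L"
    "fls_subdegree L = - int (length \<alpha>)" "\<And>N. fls_nth L N = multi_bernoulli N a \<alpha>"
proof -
  from has_laurent_expansion_barnes_kernel[OF assms] obtain F where F:
    "barnes_kernel \<alpha> has_laurent_expansion F" "fls_subdegree F = - int (length \<alpha>)" "F \<noteq> 0"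
    by blast
  define L where "L = fps_to_fls (fps_exp (- a)) * F"
  have L: "(\<lambda>t. exp (- a * t) * barnes_kernel \<alpha> t) has_laurent_expansion L"
    unfolding L_def
    by (intro laurent_expansion_intros has_laurent_expansion_fps fps_expansion_intros F)
  have "inverse (\<Prod>z\<leftarrow>\<alpha>. 1 - exp (- (z * t))) = barnes_kernel \<alpha> t" for t
    by (induction \<alpha>) (auto simp: barnes_kernel_def)
  hence "(\<lambda>t. exp (- a * t) / (\<Prod>z\<leftarrow>\<alpha>. 1 - exp (- z * t))) =
      (\<lambda>t. exp (- a * t) * barnes_kernel \<alpha> t)"
    by (simp add: divide_inverse)
  hence "multi_bernoulli N a \<alpha> = fls_nth L N" for N
    using laurent_expansion_0_eqI[OF L] by (simp add: multi_bernoulli_def)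
  moreover have "fls_subdegree L = - int (length \<alpha>)"
    using F by (simp add: L_def fls_subdegree_fls_to_fps)
  ultimately show ?thesis
    using that L by metis
qed

text \<open>A shift of the argument preserves the leading coefficient, so the leading terms cancel.
  This is where the logarithm loses one power, from \<open>m\<close> to
  \<open>m - 1\<close>.\<close>

lemma degree_pcompose_shift_diff:
  fixes p :: "'a :: idom poly"
  assumes "degree p \<le> Suc n"
  shows "degree (pcompose p [:c, 1:] - p) \<le> n"
proof (rule degree_le, intro allI impI)
  fix i assume "n < i"
  show "coeff (pcompose p [:c, 1:] - p) i = 0"
  proof (cases "i = degree p")
    case True
    have "coeff (pcompose p [:c, 1:]) (degree (pcompose p [:c, 1:])) = lead_coeff p"
      by (subst lead_coeff_comp) auto
    hence "coeff (pcompose p [:c, 1:]) (degree p) = lead_coeff p"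
      by (simp add: degree_pcompose)
    thus ?thesis
      by (simp add: True)
  next
    case False
    with assms \<open>n < i\<close> have "degree p < i"
      by simp
    thus ?thesis
      by (simp add: coeff_eq_0 degree_pcompose)
  qed
qed

subsection \<open>Laplace integrals along a ray\<close>

text \<open>The derivative of \<open>\<surd>y / (1 + \<surd>y)\<close>: it dominates \<open>e\<^sup>-\<^sup>y\<close> times powers of \<open>y\<close> and \<open>ln y\<close>, and
  having an elementary bounded primitive it avoids Gamma integrals.\<close>

definition majorant :: "real \<Rightarrow> real" where
  "majorant y = 1 / (2 * sqrt y * (1 + sqrt y)\<^sup>2)"

lemma majorant_nonneg: "y \<ge> 0 \<Longrightarrow> majorant y \<ge> 0"
  by (simp add: majorant_def)

lemma has_integral_majorant:
  assumes "w > 0" "\<epsilon> > 0"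
  shows "((\<lambda>x. majorant (w * x)) has_integral 1 / (w * (1 + sqrt (w * \<epsilon>)))) {\<epsilon>..}"
proof -
  \<comment> \<open>The primitive \<open>sqrt y / (1 + sqrt y)\<close> at \<open>y = w * x\<close>,
    divided by \<open>w\<close> and lowered by \<open>1 / w\<close> so that it tends to 0 at
    infinity.\<close>
  define A where "A = (\<lambda>x. - 1 / (w * (1 + sqrt (w * x))))"
  have deriv: "(A has_real_derivative majorant (w * x)) (at x)" if "x > 0" for x
  proof -
    define s where "s = sqrt (w * x)"
    have "w * x > 0"
      using that assms by simp
    hence s: "s > 0"
      by (simp add: s_def)
    have "((\<lambda>x. 1 + sqrt (w * x)) has_real_derivative w / (2 * s)) (at x)"
      using \<open>w * x > 0\<close> by (auto intro!: derivative_eq_intros simp: s_def field_simps)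
    hence "((\<lambda>x. inverse (1 + sqrt (w * x))) has_real_derivative
        - (inverse (1 + s) * (w / (2 * s)) * inverse (1 + s))) (at x)"
      using add_pos_pos[OF zero_less_one s] unfolding s_def by (intro DERIV_inverse') simp_all
    from DERIV_cmult[OF this, of "- 1 / w"] show ?thesis
      using s assms
      by (simp add: A_def majorant_def s_def[symmetric] divide_simps power2_eq_square mult_ac)
  qed
  have int: "((\<lambda>x. majorant (w * x)) has_integral (A y - A \<epsilon>)) {\<epsilon>..y}" if "y \<ge> \<epsilon>" for y
  proof (rule fundamental_theorem_of_calculus)
    fix x assume "x \<in> {\<epsilon>..y}"
    with assms have "x > 0"
      by simp
    from deriv[OF this] show "(A has_vector_derivative majorant (w * x)) (at x within {\<epsilon>..y})"
      by (simp add: has_real_derivative_iff_has_vector_derivative has_vector_derivative_at_within)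
  qed fact
  show ?thesis
  proof (rule has_integral_to_inf)
    show "(\<lambda>x. majorant (w * x)) integrable_on {\<epsilon>..y}" for y
      using int[of y] by (cases "y \<ge> \<epsilon>") auto
    have "eventually (\<lambda>y. A y - A \<epsilon> = integral {\<epsilon>..y} (\<lambda>x. majorant (w * x))) at_top"
      using eventually_ge_at_top[of \<epsilon>] by eventually_elim (rule integral_unique[OF int, symmetric])
    moreover have "((\<lambda>y. A y - A \<epsilon>) \<longlongrightarrow> 0 - A \<epsilon>) at_top"
    proof (intro tendsto_diff tendsto_const)
      show "(A \<longlongrightarrow> 0) at_top"
        unfolding A_def using assms(1) by real_asymp
    qed
    ultimately show "((\<lambda>y. integral {\<epsilon>..y} (\<lambda>x. majorant (w * x))) \<longlongrightarrow>
        1 / (w * (1 + sqrt (w * \<epsilon>)))) at_top"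
      by (simp add: A_def tendsto_cong)
    show "majorant (w * y) \<ge> 0" if "y \<ge> \<epsilon>" for y
      using that assms by (intro majorant_nonneg) auto
  qed
qed

lemma exp_poly_ln_le_majorant:
  obtains K where "K > 0" "\<And>y. y > 0 \<Longrightarrow> exp (- y) * (1 + y) ^ p * (1 + \<bar>ln y\<bar>) ^ n \<le> K * majorant y"
proof -
  \<comment> \<open>The left-hand side divided by \<open>majorant y\<close>. At 0 the factor
    \<open>sqrt y\<close> absorbs the logarithms, at infinity the exponential absorbs everything,
    and compactness handles the rest.\<close>
  define \<phi> where
    "\<phi> = (\<lambda>y::real. exp (- y) * (1 + y) ^ p * (1 + \<bar>ln y\<bar>) ^ n * (2 * sqrt y * (1 + sqrt y)\<^sup>2))"
  have "(\<phi> \<longlongrightarrow> 0) at_top" "(\<phi> \<longlongrightarrow> 0) (at_right 0)"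
    unfolding \<phi>_def by real_asymp+
  hence "eventually (\<lambda>y. \<phi> y < 1) at_top" "eventually (\<lambda>y. \<phi> y < 1) (at_right 0)"
    by (auto intro: order_tendstoD)
  then obtain a b where a: "a > 0" "\<And>y. y > 0 \<Longrightarrow> y < a \<Longrightarrow> \<phi> y < 1"
    and b: "\<And>y. y \<ge> b \<Longrightarrow> \<phi> y < 1"
    by (auto simp: eventually_at_right_field eventually_at_top_linorder)
  have "compact (\<phi> ` {a..b})"
    unfolding \<phi>_def using a(1) by (intro compact_continuous_image continuous_intros) auto
  then obtain M where M: "\<And>y. y \<in> {a..b} \<Longrightarrow> \<phi> y \<le> M"
    by (meson bounded_imp_bdd_above compact_imp_bounded bdd_above.E imageI)
  have *: "\<phi> y \<le> max 1 M" if "y > 0" for y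
    using a b M that by (smt (verit) atLeastAtMost_iff)
  show ?thesis
  proof (rule that[of "max 1 M"])
    fix y :: real assume y: "y > 0"
    hence "2 * sqrt y * (1 + sqrt y)\<^sup>2 > 0"
      by (auto intro!: mult_pos_pos zero_less_power add_pos_pos)
    thus "exp (- y) * (1 + y) ^ p * (1 + \<bar>ln y\<bar>) ^ n \<le> max 1 M * majorant y"
      using *[OF y] unfolding \<phi>_def majorant_def by (simp only: mult_1_right times_divide_eq_right pos_le_divide_eq)
  qed auto
qed

text \<open>The substitution \<open>y = w * x\<close>. From \<open>ln x = ln y - ln w\<close>
  follows \<open>1 + \<bar>ln x\<bar> \<le> (1 + ln w) * (1 + \<bar>ln y\<bar>)\<close>, which is
  the source of the powers of \<open>ln w\<close>; since \<open>w \<ge> 1\<close>, the factor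
  \<open>(1 + x) ^ p\<close> only grows when \<open>x\<close> is replaced by
  \<open>y\<close>.\<close>

lemma exp_poly_ln_le_scaled_majorant:
  obtains K where "K > 0" "\<And>w x. w \<ge> 1 \<Longrightarrow> x > 0 \<Longrightarrow>
    exp (- (w * x)) * (1 + x) ^ p * (1 + \<bar>ln x\<bar>) ^ n \<le> K * (1 + ln w) ^ n * majorant (w * x)"
proof -
  obtain K where K: "K > 0"
    "\<And>y. y > 0 \<Longrightarrow> exp (- y) * (1 + y) ^ p * (1 + \<bar>ln y\<bar>) ^ n \<le> K * majorant y"
    using exp_poly_ln_le_majorant[where p = p and n = n] by blast
  show ?thesis
  proof (rule that[OF K(1)])
    fix w x :: real assume wx: "w \<ge> 1" "x > 0"
    define y where "y = w * x"
    have y: "y > 0" "x \<le> y" "ln x = ln y - ln w" "ln w \<ge> 0"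
      using wx by (auto simp: y_def ln_mult)
    have "0 \<le> \<bar>ln y\<bar> * ln w"
      using y by simp
    moreover have "(1 + ln w) * (1 + \<bar>ln y\<bar>) = 1 + ln w + \<bar>ln y\<bar> + \<bar>ln y\<bar> * ln w"
      by (simp add: algebra_simps)
    ultimately have "1 + \<bar>ln x\<bar> \<le> (1 + ln w) * (1 + \<bar>ln y\<bar>)"
      using y by linarith
    hence "(1 + \<bar>ln x\<bar>) ^ n \<le> ((1 + ln w) * (1 + \<bar>ln y\<bar>)) ^ n"
      by (intro power_mono) auto
    moreover have "(1 + x) ^ p \<le> (1 + y) ^ p"
      using wx y by (intro power_mono) auto
    ultimately have "exp (- y) * (1 + x) ^ p * (1 + \<bar>ln x\<bar>) ^ n \<le>
        exp (- y) * (1 + y) ^ p * ((1 + ln w) * (1 + \<bar>ln y\<bar>)) ^ n"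
      using wx y by (intro mult_mono) auto
    also have "\<dots> = (1 + ln w) ^ n * (exp (- y) * (1 + y) ^ p * (1 + \<bar>ln y\<bar>) ^ n)"
      by (simp add: power_mult_distrib mult_ac)
    also have "\<dots> \<le> (1 + ln w) ^ n * (K * majorant y)"
      using y by (intro mult_left_mono K) auto
    finally show "exp (- (w * x)) * (1 + x) ^ p * (1 + \<bar>ln x\<bar>) ^ n \<le>
        K * (1 + ln w) ^ n * majorant (w * x)"
      by (simp add: y_def mult_ac)
  qed
qed

lemma poly_growth:
  fixes p :: "'a :: real_normed_field poly"
  assumes "degree p \<le> n"
  obtains C where "C > 0" "\<And>x. norm (poly p x) \<le> C * (1 + norm x) ^ n"
proof -
  have "norm (poly p x) \<le> (\<Sum>i\<le>degree p. norm (coeff p i)) * (1 + norm x) ^ n" for x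
    unfolding poly_altdef sum_distrib_right
  proof (intro sum_norm_le)
    fix i assume i: "i \<in> {..degree p}"
    have "norm x ^ i \<le> (1 + norm x) ^ i"
      by (intro power_mono) auto
    also have "\<dots> \<le> (1 + norm x) ^ n"
      using i assms by (intro power_increasing) auto
    finally show "norm (coeff p i * x ^ i) \<le> norm (coeff p i) * (1 + norm x) ^ n"
      by (simp add: norm_mult norm_power mult_left_mono)
  qed
  \<comment> \<open>The added 1 keeps the constant positive for the zero polynomial.\<close>
  moreover have "(\<Sum>i\<le>degree p. norm (coeff p i)) * (1 + norm x) ^ n \<le>
      (1 + (\<Sum>i\<le>degree p. norm (coeff p i))) * (1 + norm x) ^ n" for x :: 'a
    by (intro mult_right_mono) auto
  ultimately have "norm (poly p x) \<le> (1 + (\<Sum>i\<le>degree p. norm (coeff p i))) * (1 + norm x) ^ n" for x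
    using order.trans by blast
  thus ?thesis
    by (intro that[of "1 + (\<Sum>i\<le>degree p. norm (coeff p i))"]) (auto simp: add_pos_nonneg sum_nonneg)
qed

text \<open>The constant \<open>K\<close> is fixed before \<open>w\<close>, \<epsilon> and
  \<open>F\<close>. Its independence of \<epsilon> allows the circle to shrink, and its independence
  of \<open>w\<close> gives the asymptotic bound. Integrability and estimate both come from
  domination by the scaled majorant.\<close>

lemma ray_integral:
  fixes q :: "complex poly" and C :: real
  assumes "degree q \<le> n"
  obtains K where "\<And>w \<epsilon> F. w \<ge> 1 \<Longrightarrow> \<epsilon> > 0 \<Longrightarrow> continuous_on {\<epsilon>..} F \<Longrightarrow>
      (\<And>x. x \<ge> \<epsilon> \<Longrightarrow> cmod (F x) \<le> C * (1 + x) ^ p) \<Longrightarrow>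
      (\<lambda>x. F x * exp (- (of_real w * of_real x)) * poly q (of_real (ln x))) integrable_on {\<epsilon>..} \<and>
      cmod (integral {\<epsilon>..} (\<lambda>x. F x * exp (- (of_real w * of_real x)) * poly q (of_real (ln x))))
        \<le> K * (1 + ln w) ^ n / w"
proof -
  obtain K where K: "K > 0" "\<And>w x. w \<ge> 1 \<Longrightarrow> x > 0 \<Longrightarrow>
      exp (- (w * x)) * (1 + x) ^ p * (1 + \<bar>ln x\<bar>) ^ n \<le> K * (1 + ln w) ^ n * majorant (w * x)"
    using exp_poly_ln_le_scaled_majorant[where p = p and n = n] by blast
  obtain B where B: "B > 0" "\<And>x. norm (poly q x) \<le> B * (1 + norm x) ^ n"
    using poly_growth[OF assms] by blast
  show ?thesis
  proof (rule that[of "\<bar>C\<bar> * B * K"])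
    fix w \<epsilon> :: real and F :: "real \<Rightarrow> complex"
    assume w: "w \<ge> 1" and \<epsilon>: "\<epsilon> > 0" and cont: "continuous_on {\<epsilon>..} F"
      and bound: "\<And>x. x \<ge> \<epsilon> \<Longrightarrow> cmod (F x) \<le> C * (1 + x) ^ p"
    define f where "f = (\<lambda>x. F x * exp (- (of_real w * of_real x)) * poly q (of_real (ln x)))"
    define h where "h = (\<lambda>x. \<bar>C\<bar> * B * K * (1 + ln w) ^ n * majorant (w * x))"
    define I where "I = \<bar>C\<bar> * B * K * (1 + ln w) ^ n * (1 / (w * (1 + sqrt (w * \<epsilon>))))"
    have h: "(h has_integral I) {\<epsilon>..}"
      unfolding h_def I_def using w \<epsilon>
      by (intro has_integral_mult_right has_integral_majorant) auto
    have "norm (f x) \<le> h x" if "x \<in> {\<epsilon>..}" for x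
    proof -
      have x: "x > 0" "x \<ge> \<epsilon>"
        using that \<epsilon> by auto
      have "C * (1 + x) ^ p \<le> \<bar>C\<bar> * (1 + x) ^ p"
        using x by (intro mult_right_mono) auto
      hence F: "cmod (F x) \<le> \<bar>C\<bar> * (1 + x) ^ p"
        using bound[OF x(2)] by linarith
      have "norm (f x) = cmod (F x) * exp (- (w * x)) * cmod (poly q (of_real (ln x)))"
        by (simp add: f_def norm_mult)
      also have "\<dots> \<le> (\<bar>C\<bar> * (1 + x) ^ p) * exp (- (w * x)) * (B * (1 + \<bar>ln x\<bar>) ^ n)"
        using F B(1) B(2)[of "of_real (ln x)"] x by (intro mult_mono) auto
      also have "\<dots> = \<bar>C\<bar> * B * (exp (- (w * x)) * (1 + x) ^ p * (1 + \<bar>ln x\<bar>) ^ n)"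
        by (simp add: mult_ac)
      also have "\<dots> \<le> \<bar>C\<bar> * B * (K * (1 + ln w) ^ n * majorant (w * x))"
        using w x B(1) by (intro mult_left_mono K) auto
      finally show ?thesis
        by (simp add: h_def mult_ac)
    qed
    moreover have "continuous_on {\<epsilon>..} f"
      unfolding f_def using \<epsilon> by (intro continuous_intros cont) auto
    hence "f \<in> borel_measurable (lebesgue_on {\<epsilon>..})"
      by (intro continuous_imp_measurable_on_sets_lebesgue) auto
    ultimately have "f integrable_on {\<epsilon>..}" "norm (integral {\<epsilon>..} f) \<le> I"
      using measurable_bounded_by_integrable_imp_integrable[of f "{\<epsilon>..}" h]
        integral_norm_bound_integral'[of "{\<epsilon>..}" f h I] h has_integral_integrable
      by (auto simp: has_integral_integrable)
    \<comment> \<open>Dropping the factor \<open>1 + sqrt (w * \<epsilon>) \<ge> 1\<close> from the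
      denominator removes \<epsilon> from the bound.\<close>
    moreover have "I \<le> \<bar>C\<bar> * B * K * (1 + ln w) ^ n * (1 / w)"
      unfolding I_def using B K w \<epsilon>
      by (intro mult_left_mono frac_le) (auto simp: mult_le_cancel_left1)
    ultimately show "f integrable_on {\<epsilon>..} \<and> cmod (integral {\<epsilon>..} f) \<le> \<bar>C\<bar> * B * K * (1 + ln w) ^ n / w"
      by auto
  qed
qed

subsection \<open>Amplitudes\<close>

text \<open>The constants may depend on \<delta>, so a pole at the origin is permitted.\<close>

definition slow_growth :: "(complex \<Rightarrow> complex) \<Rightarrow> bool" where
  "slow_growth F \<longleftrightarrow> (\<forall>\<delta>>0. \<exists>C p. \<forall>x\<ge>\<delta>. cmod (F (of_real x)) \<le> C * (1 + x) ^ p)"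

lemma slow_growthE:
  assumes "slow_growth F" "\<delta> > 0"
  obtains C p where "C > 0" "\<And>x. x \<ge> \<delta> \<Longrightarrow> cmod (F (of_real x)) \<le> C * (1 + x) ^ p"
proof -
  obtain C p where C: "\<And>x. x \<ge> \<delta> \<Longrightarrow> cmod (F (of_real x)) \<le> C * (1 + x) ^ p"
    using assms unfolding slow_growth_def by metis
  have "C * (1 + x) ^ p \<le> max 1 C * (1 + x) ^ p" if "x \<ge> \<delta>" for x
    using that assms by (intro mult_right_mono) auto
  thus ?thesis
    using that[of "max 1 C" p] C by (meson order.trans max.strict_coboundedI1 zero_less_one)
qed

lemma slow_growth_bounded:
  assumes "\<And>\<delta>. \<delta> > 0 \<Longrightarrow> \<exists>C. \<forall>x\<ge>\<delta>. cmod (F (of_real x)) \<le> C"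
  shows "slow_growth F"
  unfolding slow_growth_def
proof (intro allI impI)
  fix \<delta> :: real assume "\<delta> > 0"
  from assms[OF this] obtain C where "\<forall>x\<ge>\<delta>. cmod (F (of_real x)) \<le> C" ..
  thus "\<exists>C p. \<forall>x\<ge>\<delta>. cmod (F (of_real x)) \<le> C * (1 + x) ^ p"
    by (intro exI[of _ C] exI[of _ 0]) auto
qed

lemma slow_growth_mult:
  assumes "slow_growth F" "slow_growth G"
  shows "slow_growth (\<lambda>t. F t * G t)"
  unfolding slow_growth_def
proof (intro allI impI)
  fix \<delta> :: real assume \<delta>: "\<delta> > 0"
  obtain C p where C: "C > 0" "\<And>x. x \<ge> \<delta> \<Longrightarrow> cmod (F (of_real x)) \<le> C * (1 + x) ^ p"
    using slow_growthE[OF assms(1) \<delta>] by blast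
  obtain D q where D: "D > 0" "\<And>x. x \<ge> \<delta> \<Longrightarrow> cmod (G (of_real x)) \<le> D * (1 + x) ^ q"
    using slow_growthE[OF assms(2) \<delta>] by blast
  have "cmod (F (of_real x) * G (of_real x)) \<le> (C * D) * (1 + x) ^ (p + q)" if "x \<ge> \<delta>" for x
  proof -
    have "cmod (F (of_real x) * G (of_real x)) \<le> (C * (1 + x) ^ p) * (D * (1 + x) ^ q)"
      unfolding norm_mult using that \<delta> C(1) by (intro mult_mono C D) auto
    thus ?thesis
      by (simp add: power_add mult_ac)
  qed
  thus "\<exists>C p. \<forall>x\<ge>\<delta>. cmod (F (of_real x) * G (of_real x)) \<le> C * (1 + x) ^ p"
    by blast
qed

lemma slow_growth_add:
  assumes "slow_growth F" "slow_growth G"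
  shows "slow_growth (\<lambda>t. F t + G t)"
  unfolding slow_growth_def
proof (intro allI impI)
  fix \<delta> :: real assume \<delta>: "\<delta> > 0"
  obtain C p where C: "C > 0" "\<And>x. x \<ge> \<delta> \<Longrightarrow> cmod (F (of_real x)) \<le> C * (1 + x) ^ p"
    using slow_growthE[OF assms(1) \<delta>] by blast
  obtain D q where D: "D > 0" "\<And>x. x \<ge> \<delta> \<Longrightarrow> cmod (G (of_real x)) \<le> D * (1 + x) ^ q"
    using slow_growthE[OF assms(2) \<delta>] by blast
  have "cmod (F (of_real x) + G (of_real x)) \<le> (C + D) * (1 + x) ^ (p + q)" if "x \<ge> \<delta>" for x
  proof -
    have "cmod (F (of_real x) + G (of_real x)) \<le> C * (1 + x) ^ p + D * (1 + x) ^ q"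
      using that by (intro norm_triangle_mono C D)
    also have "\<dots> \<le> C * (1 + x) ^ (p + q) + D * (1 + x) ^ (p + q)"
      using that \<delta> C(1) D(1) by (intro add_mono mult_left_mono power_increasing) auto
    finally show ?thesis
      by (simp add: algebra_simps)
  qed
  thus "\<exists>C p. \<forall>x\<ge>\<delta>. cmod (F (of_real x) + G (of_real x)) \<le> C * (1 + x) ^ p"
    by blast
qed

lemma slow_growth_const: "slow_growth (\<lambda>_. c)"
  by (rule slow_growth_bounded) auto

lemma slow_growth_power_int: "slow_growth (\<lambda>t. t powi n)"
  unfolding slow_growth_def
proof (intro allI impI)
  fix \<delta> :: real assume \<delta>: "\<delta> > 0"
  show "\<exists>C p. \<forall>x\<ge>\<delta>. cmod (of_real x powi n) \<le> C * (1 + x) ^ p"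
  proof (cases "n \<ge> 0")
    case True
    have "cmod (of_real x powi n) \<le> 1 * (1 + x) ^ nat n" if "x \<ge> \<delta>" for x
      using True that \<delta> by (auto simp: power_int_def norm_power intro!: power_mono)
    thus ?thesis
      by blast
  next
    case False
    have "cmod (of_real x powi n) \<le> inverse \<delta> ^ nat (- n) * (1 + x) ^ 0" if "x \<ge> \<delta>" for x
      using False that \<delta>
      by (auto simp: power_int_def norm_power norm_inverse intro!: power_mono le_imp_inverse_le)
    thus ?thesis
      by blast
  qed
qed

lemma slow_growth_exp:
  assumes "Re a \<ge> 0"
  shows "slow_growth (\<lambda>t. exp (- a * t))"
proof (rule slow_growth_bounded)
  fix \<delta> :: real assume "\<delta> > 0"
  thus "\<exists>C. \<forall>x\<ge>\<delta>. cmod (exp (- a * of_real x)) \<le> C"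
    using assms by (intro exI[of _ 1]) auto
qed

text \<open>On the ray \<open>x \<ge> \<delta>\<close> the exponential has modulus at most
  \<open>exp (- (Re z * \<delta>)) < 1\<close>, and the reverse triangle inequality keeps the
  denominator away from 0.\<close>

lemma slow_growth_inverse_one_minus_exp:
  assumes "Re z > 0"
  shows "slow_growth (\<lambda>t. inverse (1 - exp (- z * t)))"
proof (rule slow_growth_bounded)
  fix \<delta> :: real assume \<delta>: "\<delta> > 0"
  have "cmod (inverse (1 - exp (- z * of_real x))) \<le> inverse (1 - exp (- (Re z * \<delta>)))"
    if "x \<ge> \<delta>" for x
  proof -
    have "0 < 1 - exp (- (Re z * \<delta>))"
      using assms \<delta> by simp
    moreover have "cmod (exp (- z * of_real x)) \<le> exp (- (Re z * \<delta>))"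
      using assms that by simp
    moreover have "1 - cmod (exp (- z * of_real x)) \<le> cmod (1 - exp (- z * of_real x))"
      using norm_triangle_ineq2[of 1 "exp (- z * of_real x)"] by simp
    ultimately show ?thesis
      unfolding norm_inverse by (intro le_imp_inverse_le) linarith+
  qed
  thus "\<exists>C. \<forall>x\<ge>\<delta>. cmod (inverse (1 - exp (- z * of_real x))) \<le> C"
    by blast
qed

text \<open>Holomorphy on the punctured disc serves the circle, continuity and growth on the
  positive axis serve the two rays. Poles off the axis at distance at least \<open>R\<close> are
  thereby tolerated.\<close>

definition hankel_amplitude :: "real \<Rightarrow> (complex \<Rightarrow> complex) \<Rightarrow> bool" where
  "hankel_amplitude R F \<longleftrightarrow> F holomorphic_on ball 0 R - {0} \<and>
     continuous_on {0<..} (\<lambda>x. F (of_real x)) \<and> slow_growth F"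

lemma hankel_amplitude_mult:
  "hankel_amplitude R F \<Longrightarrow> hankel_amplitude R G \<Longrightarrow> hankel_amplitude R (\<lambda>t. F t * G t)"
  by (auto simp: hankel_amplitude_def intro!: holomorphic_intros continuous_intros slow_growth_mult)

lemma hankel_amplitude_add:
  "hankel_amplitude R F \<Longrightarrow> hankel_amplitude R G \<Longrightarrow> hankel_amplitude R (\<lambda>t. F t + G t)"
  by (auto simp: hankel_amplitude_def intro!: holomorphic_intros continuous_intros slow_growth_add)

lemma hankel_amplitude_const: "hankel_amplitude R (\<lambda>_. c)"
  by (auto simp: hankel_amplitude_def intro!: slow_growth_const)

lemma hankel_amplitude_sum:
  "(\<And>i. i \<in> I \<Longrightarrow> hankel_amplitude R (F i)) \<Longrightarrow> hankel_amplitude R (\<lambda>t. \<Sum>i\<in>I. F i t)"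
  by (induction I rule: infinite_finite_induct)
     (auto intro: hankel_amplitude_add hankel_amplitude_const)

lemma hankel_amplitude_power_int: "hankel_amplitude R (\<lambda>t. t powi n)"
  by (auto simp: hankel_amplitude_def intro!: slow_growth_power_int holomorphic_intros continuous_intros)

lemma hankel_amplitude_exp: "Re a \<ge> 0 \<Longrightarrow> hankel_amplitude R (\<lambda>t. exp (- a * t))"
  unfolding hankel_amplitude_def
  by (intro conjI slow_growth_exp holomorphic_intros continuous_intros)

text \<open>Here \<open>z * t\<close> is a nonzero multiple of \<open>2 * pi * \<i>\<close>, hence
  has modulus at least \<open>2 * pi\<close>. This identifies the radius up to which the kernel has
  no pole besides the origin.\<close>

lemma exp_eq_1_imp_norm_ge:
  assumes "exp (- z * t) = 1" "z \<noteq> 0" "t \<noteq> 0"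
  shows "cmod (2 * of_real pi / z) \<le> cmod t"
proof -
  obtain n :: int where n: "- z * t = of_int (2 * n) * pi * \<i>"
    using assms(1) exp_eq[of "- z * t" 0] by auto
  have "n \<noteq> 0"
    using n assms by auto
  hence "1 \<le> \<bar>real_of_int n\<bar>"
    by linarith
  hence "2 * pi * 1 \<le> 2 * pi * \<bar>real_of_int n\<bar>"
    by (intro mult_left_mono) auto
  also have "\<dots> = cmod (- z * t)"
    unfolding n by (simp add: norm_mult)
  finally show ?thesis
    using assms by (simp add: norm_divide norm_mult divide_le_eq mult_ac)
qed

text \<open>Zeros of the denominators are excluded in the disc by the choice of \<open>R\<close>,
  and on the positive axis because \<open>Re z > 0\<close> makes the exponential smaller than 1 in
  modulus.\<close>

lemma hankel_amplitude_barnes_kernel: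
  assumes "\<And>z. z \<in> set \<omega> \<Longrightarrow> Re z > 0" "\<And>z. z \<in> set \<omega> \<Longrightarrow> R \<le> cmod (2 * of_real pi / z)"
  shows "hankel_amplitude R (barnes_kernel \<omega>)"
  using assms
proof (induction \<omega>)
  case Nil
  thus ?case
    by (simp add: barnes_kernel_def [abs_def] hankel_amplitude_const)
next
  case (Cons z \<omega>)
  have z: "Re z > 0" "z \<noteq> 0" "R \<le> cmod (2 * of_real pi / z)"
    using Cons.prems(1)[of z] Cons.prems(2)[of z] by auto
  have "1 - exp (- z * t) \<noteq> 0" if "t \<in> ball 0 R - {0}" for t
    using exp_eq_1_imp_norm_ge[of z t] z that by (auto simp del: mult_minus_left)
  moreover have "1 - exp (- z * of_real x) \<noteq> 0" if "x > 0" for x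
  proof
    assume "1 - exp (- z * of_real x) = 0"
    hence "cmod (exp (- z * of_real x)) = 1"
      by simp
    thus False
      using z that by simp
  qed
  ultimately have "hankel_amplitude R (\<lambda>t. inverse (1 - exp (- z * t)))"
    unfolding hankel_amplitude_def
    by (intro conjI slow_growth_inverse_one_minus_exp z holomorphic_intros continuous_intros) auto
  from hankel_amplitude_mult[OF this Cons.IH[OF Cons.prems]]
  show ?case
    by (simp add: barnes_kernel_def [abs_def])
qed

subsection \<open>Hankel integrals\<close>

text \<open>The amplitude and the exponential are functions of \<open>t = exp u\<close>; only the
  polynomial distinguishes the branches of the logarithm.\<close>

definition hankel_kernel :: "(complex \<Rightarrow> complex) \<Rightarrow> real \<Rightarrow> complex poly \<Rightarrow> complex \<Rightarrow> complex" where
  "hankel_kernel F w q u = F (exp u) * exp (- (of_real w * exp u)) * poly q u"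

lemma hankel_kernel_lower:
  "x > 0 \<Longrightarrow> hankel_kernel F w q (of_real (ln x)) =
     F (of_real x) * exp (- (of_real w * of_real x)) * poly q (of_real (ln x))"
  by (simp add: hankel_kernel_def exp_of_real)

text \<open>Adding \<open>2 * pi * \<i>\<close> to \<open>u\<close> leaves \<open>t\<close>
  unchanged, so the outgoing ray carries the integrand of the incoming one with a shifted
  polynomial.\<close>

lemma hankel_kernel_upper:
  "x > 0 \<Longrightarrow> hankel_kernel F w q (of_real (ln x) + 2 * of_real pi * \<i>) =
     F (of_real x) * exp (- (of_real w * of_real x)) *
       poly (pcompose q [:2 * of_real pi * \<i>, 1:]) (of_real (ln x))"
  by (simp add: hankel_kernel_def exp_add exp_of_real poly_pcompose add_ac)

lemma hankel_kernel_holomorphic: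
  assumes "hankel_amplitude R F"
  shows "hankel_kernel F w q holomorphic_on {u. exp (Re u) < R}"
proof -
  have "(F \<circ> exp) holomorphic_on {u. exp (Re u) < R}"
    using assms unfolding hankel_amplitude_def
    by (intro holomorphic_on_compose_gen[where t = "ball 0 R - {0}"] holomorphic_intros) auto
  thus ?thesis
    unfolding hankel_kernel_def [abs_def] o_def by (intro holomorphic_intros) auto
qed

lemma hankel_kernel_integrable:
  assumes F: "hankel_amplitude R F" and w: "w \<ge> 1" and "0 < \<rho>"
  shows "(\<lambda>x. hankel_kernel F w q (of_real (ln x))) integrable_on {\<rho>..}" (is ?lower)
    and "(\<lambda>x. hankel_kernel F w q (of_real (ln x) + 2 * of_real pi * \<i>)) integrable_on {\<rho>..}" (is ?upper)
    and "\<rho> < R \<Longrightarrow> (\<lambda>\<theta>. hankel_kernel F w q (of_real (ln \<rho>) + \<i> * of_real \<theta>) *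
             (\<i> * of_real \<rho> * cis \<theta>)) integrable_on {0..2 * pi}"
proof -
  obtain C p where C: "C > 0" "\<And>x. x \<ge> \<rho> \<Longrightarrow> cmod (F (of_real x)) \<le> C * (1 + x) ^ p"
    using F slow_growthE[of F \<rho>] \<open>0 < \<rho>\<close> by (auto simp: hankel_amplitude_def)
  have cont: "continuous_on {\<rho>..} (\<lambda>x. F (of_real x))"
    using F \<open>0 < \<rho>\<close> by (auto simp: hankel_amplitude_def intro: continuous_on_subset)
  have *: "(\<lambda>x. F (of_real x) * exp (- (of_real w * of_real x)) * poly q (of_real (ln x)))
             integrable_on {\<rho>..}" for q
  proof (rule ray_integral[OF order_refl, where q = q and C = C and p = p])
    fix K
    assume *: "\<And>w \<epsilon> F. w \<ge> 1 \<Longrightarrow> \<epsilon> > 0 \<Longrightarrow> continuous_on {\<epsilon>..} F \<Longrightarrow>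
        (\<And>x. x \<ge> \<epsilon> \<Longrightarrow> cmod (F x) \<le> C * (1 + x) ^ p) \<Longrightarrow>
        (\<lambda>x. F x * exp (- (of_real w * of_real x)) * poly q (of_real (ln x))) integrable_on {\<epsilon>..} \<and>
        cmod (integral {\<epsilon>..} (\<lambda>x. F x * exp (- (of_real w * of_real x)) * poly q (of_real (ln x))))
          \<le> K * (1 + ln w) ^ degree q / w"
    show ?thesis
      using *[OF w \<open>0 < \<rho>\<close> cont C(2)] by blast
  qed
  show ?lower
    using *[of q] by (rule integrable_eq) (use \<open>0 < \<rho>\<close> in \<open>auto simp: hankel_kernel_lower\<close>)
  show ?upper
    using * by (rule integrable_eq) (use \<open>0 < \<rho>\<close> in \<open>auto simp: hankel_kernel_upper\<close>)
  assume "\<rho> < R"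
  have "continuous_on {0..2 * pi} (\<lambda>\<theta>. hankel_kernel F w q (of_real (ln \<rho>) + \<i> * of_real \<theta>))"
    using \<open>\<rho> < R\<close> \<open>0 < \<rho>\<close>
    by (intro continuous_on_compose2[OF holomorphic_on_imp_continuous_on[OF hankel_kernel_holomorphic[OF F]]]
          continuous_intros) auto
  thus "(\<lambda>\<theta>. hankel_kernel F w q (of_real (ln \<rho>) + \<i> * of_real \<theta>) * (\<i> * of_real \<rho> * cis \<theta>))
          integrable_on {0..2 * pi}"
    by (intro integrable_continuous_interval continuous_intros)
qed

lemma hankel_integral_add:
  assumes "hankel_amplitude R F" "hankel_amplitude R G" "w \<ge> 1" "0 < \<rho>" "\<rho> < R"
  shows "hankel_integral \<rho> (hankel_kernel (\<lambda>t. F t + G t) w q) =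
    hankel_integral \<rho> (hankel_kernel F w q) + hankel_integral \<rho> (hankel_kernel G w q)"
proof -
  have *: "hankel_kernel (\<lambda>t. F t + G t) w q = (\<lambda>u. hankel_kernel F w q u + hankel_kernel G w q u)"
    by (simp add: hankel_kernel_def fun_eq_iff algebra_simps)
  show ?thesis
    unfolding hankel_integral_def * distrib_right
    using assms by (simp add: integral_add hankel_kernel_integrable)
qed

lemma hankel_integral_cmult:
  "hankel_integral \<rho> (hankel_kernel (\<lambda>t. c * F t) w q) = c * hankel_integral \<rho> (hankel_kernel F w q)"
proof -
  have *: "hankel_kernel (\<lambda>t. c * F t) w q = (\<lambda>u. c * hankel_kernel F w q u)"
    by (simp add: hankel_kernel_def fun_eq_iff mult_ac)
  show ?thesis
    unfolding hankel_integral_def * mult.assoc integral_mult_right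
    by (simp add: algebra_simps)
qed

lemma hankel_integral_sum:
  assumes "finite I" "\<And>i. i \<in> I \<Longrightarrow> hankel_amplitude R (F i)" "w \<ge> 1" "0 < \<rho>" "\<rho> < R"
  shows "hankel_integral \<rho> (hankel_kernel (\<lambda>t. \<Sum>i\<in>I. F i t) w q) =
    (\<Sum>i\<in>I. hankel_integral \<rho> (hankel_kernel (F i) w q))"
  using assms(1,2)
proof (induction I rule: finite_induct)
  case empty
  show ?case
    by (simp add: hankel_kernel_def hankel_integral_def)
next
  case (insert i I)
  thus ?case
    using assms(3-) by (simp add: hankel_integral_add[of R] hankel_amplitude_sum)
qed

text \<open>Used twice: to shrink the circle to the origin, and to bring all terms of the theorem to
  one radius.\<close>

lemma hankel_integral_radius:
  assumes F: "hankel_amplitude R F" and "w \<ge> 1" "0 < \<rho>" "\<rho> \<le> \<rho>'" "\<rho>' < R"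
  shows "hankel_integral \<rho> (hankel_kernel F w q) = hankel_integral \<rho>' (hankel_kernel F w q)"
proof -
  define G where "G = hankel_kernel F w q"
  define S where "S = {u. exp (Re u) < R}"
  have "R > 0"
    using assms by simp
  have S: "S = {u. Re u < ln R}"
    using \<open>R > 0\<close> by (auto simp: S_def) (metis exp_less_cancel_iff exp_ln)+
  have "convex S" "open S"
    unfolding S by (auto simp: convex_halfspace_Re_lt open_halfspace_Re_lt)
  moreover have "(\<lambda>u. G u * exp u) holomorphic_on S"
    unfolding G_def S_def by (intro holomorphic_intros hankel_kernel_holomorphic F)
  \<comment> \<open>In the coordinate \<open>u = log t\<close> the domain is a half-plane, so a primitive exists there and
    Cauchy's theorem reduces to telescoping its values.\<close>
  ultimately obtain \<Phi> where "\<And>u. u \<in> S \<Longrightarrow> (\<Phi> has_field_derivative G u * exp u) (at u within S)"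
    using holomorphic_convex_primitive'[of S "\<lambda>u. G u * exp u"] by blast
  hence \<Phi>: "(\<Phi> has_field_derivative G u * exp u) (at u)" if "u \<in> S" for u
    using that at_within_open[OF that \<open>open S\<close>] by metis
  \<comment> \<open>In the variable \<open>u\<close> the circle is the vertical segment from
    \<open>ln r\<close> to \<open>ln r + 2 * pi * \<i>\<close>.\<close>
  have circle: "integral {0..2 * pi} (\<lambda>\<theta>. G (of_real (ln r) + \<i> * of_real \<theta>) * (\<i> * of_real r * cis \<theta>))
      = \<Phi> (of_real (ln r) + 2 * of_real pi * \<i>) - \<Phi> (of_real (ln r))"
    if r: "0 < r" "r < R" for r
  proof -
    have "((\<lambda>\<theta>. G (of_real (ln r) + \<i> * of_real \<theta>) * (\<i> * of_real r * cis \<theta>)) has_integral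
        (\<lambda>\<theta>. \<Phi> (of_real (ln r) + \<i> * of_real \<theta>)) (2 * pi) - (\<lambda>\<theta>. \<Phi> (of_real (ln r) + \<i> * of_real \<theta>)) 0)
        {0..2 * pi}"
    proof (rule fundamental_theorem_of_calculus)
      fix \<theta> assume "\<theta> \<in> {0..2 * pi}"
      define u where "u = of_real (ln r) + \<i> * of_real \<theta>"
      have "u \<in> S"
        using r by (simp add: S_def u_def)
      have "exp u = of_real r * cis \<theta>"
        using r by (simp add: u_def exp_add exp_of_real cis_conv_exp)
      moreover have "((\<lambda>\<theta>. of_real (ln r) + \<i> * of_real \<theta>) has_vector_derivative \<i>) (at \<theta> within {0..2 * pi})"
        by (auto intro!: derivative_eq_intros)
      from field_vector_diff_chain_within[OF this, of \<Phi> "G u * exp u"]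
      have "((\<lambda>\<theta>. \<Phi> (of_real (ln r) + \<i> * of_real \<theta>)) has_vector_derivative \<i> * (G u * exp u)) (at \<theta> within {0..2 * pi})"
        using \<Phi>[OF \<open>u \<in> S\<close>] by (simp add: u_def o_def has_field_derivative_at_within)
      ultimately show "((\<lambda>\<theta>. \<Phi> (of_real (ln r) + \<i> * of_real \<theta>)) has_vector_derivative
          G (of_real (ln r) + \<i> * of_real \<theta>) * (\<i> * of_real r * cis \<theta>)) (at \<theta> within {0..2 * pi})"
        by (simp add: u_def mult_ac)
    qed simp
    from integral_unique[OF this] show ?thesis
      by (simp add: mult_ac)
  qed
  \<comment> \<open>The values 0 and \<open>2 * pi * \<i>\<close> of \<open>c\<close> give the
    incoming and the outgoing ray.\<close>
  have segment: "integral {\<rho>..\<rho>'} (\<lambda>x. G (of_real (ln x) + c)) =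
      \<Phi> (of_real (ln \<rho>') + c) - \<Phi> (of_real (ln \<rho>) + c)"
    if c: "exp c = 1" for c
  proof (rule integral_unique, rule fundamental_theorem_of_calculus)
    fix x assume "x \<in> {\<rho>..\<rho>'}"
    hence x: "0 < x" "x < R"
      using assms by auto
    define u where "u = of_real (ln x) + c"
    have "Re c = 0"
      using c by (metis exp_eq_1)
    hence "u \<in> S"
      using x by (simp add: S_def u_def)
    have "exp u = of_real x"
      using x c by (simp add: u_def exp_add exp_of_real)
    have "((\<lambda>x. of_real (ln x) + c) has_vector_derivative of_real (1 / x)) (at x within {\<rho>..\<rho>'})"
      using x by (auto intro!: derivative_eq_intros simp: divide_inverse)
    from field_vector_diff_chain_within[OF this, of \<Phi> "G u * exp u"]
    have "((\<lambda>x. \<Phi> (of_real (ln x) + c)) has_vector_derivative of_real (1 / x) * (G u * exp u)) (at x within {\<rho>..\<rho>'})"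
      using \<Phi>[OF \<open>u \<in> S\<close>] by (simp add: u_def o_def has_field_derivative_at_within)
    thus "((\<lambda>x. \<Phi> (of_real (ln x) + c)) has_vector_derivative G (of_real (ln x) + c)) (at x within {\<rho>..\<rho>'})"
      using x \<open>exp u = of_real x\<close> by (simp add: u_def)
  qed fact
  have ray: "integral {\<rho>..} f = integral {\<rho>..\<rho>'} f + integral {\<rho>'..} f"
    if "f integrable_on {\<rho>..}" "f integrable_on {\<rho>'..}" for f :: "real \<Rightarrow> complex"
  proof -
    have "{\<rho>..} = {\<rho>..\<rho>'} \<union> {\<rho>'..}"
      using assms by auto
    moreover have "negligible ({\<rho>..\<rho>'} \<inter> {\<rho>'..})"
      by (rule negligible_subset[of "{\<rho>'}"]) auto
    moreover have "f integrable_on {\<rho>..\<rho>'}"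
      using that(1) by (rule integrable_on_subinterval) auto
    ultimately show ?thesis
      using integral_Un[of f "{\<rho>..\<rho>'}" "{\<rho>'..}"] that(2) by simp
  qed
  have "0 < \<rho>'"
    using assms by simp
  have "integral {\<rho>..} (\<lambda>x. G (of_real (ln x))) =
      \<Phi> (of_real (ln \<rho>')) - \<Phi> (of_real (ln \<rho>)) + integral {\<rho>'..} (\<lambda>x. G (of_real (ln x)))"
    using ray[OF hankel_kernel_integrable(1)[OF F \<open>w \<ge> 1\<close> \<open>0 < \<rho>\<close>, of q]
        hankel_kernel_integrable(1)[OF F \<open>w \<ge> 1\<close> \<open>0 < \<rho>'\<close>, of q]] segment[of 0]
    by (simp add: G_def)
  moreover have "integral {\<rho>..} (\<lambda>x. G (of_real (ln x) + 2 * of_real pi * \<i>)) =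
      \<Phi> (of_real (ln \<rho>') + 2 * of_real pi * \<i>) - \<Phi> (of_real (ln \<rho>) + 2 * of_real pi * \<i>) +
      integral {\<rho>'..} (\<lambda>x. G (of_real (ln x) + 2 * of_real pi * \<i>))"
    using ray[OF hankel_kernel_integrable(2)[OF F \<open>w \<ge> 1\<close> \<open>0 < \<rho>\<close>, of q]
        hankel_kernel_integrable(2)[OF F \<open>w \<ge> 1\<close> \<open>0 < \<rho>'\<close>, of q]]
      segment[of "2 * of_real pi * \<i>"]
    by (simp add: G_def)
  \<comment> \<open>With the rays split at \<rho>', the values of \<Phi> above \<rho> cancel,
    leaving the circle of radius \<rho>' and the rays beyond it.\<close>
  ultimately show ?thesis
    using circle[of \<rho>] circle[of \<rho>'] assms
    unfolding hankel_integral_def G_def[symmetric] by simp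
qed

corollary hankel_integral_radius_eq:
  assumes "hankel_amplitude R F" "w \<ge> 1" "\<rho> \<in> {0<..<R}" "\<rho>' \<in> {0<..<R}"
  shows "hankel_integral \<rho> (hankel_kernel F w q) = hankel_integral \<rho>' (hankel_kernel F w q)"
proof (cases "\<rho> \<le> \<rho>'")
  case True
  with assms show ?thesis
    by (intro hankel_integral_radius[of R]) auto
next
  case False
  with assms have "hankel_integral \<rho>' (hankel_kernel F w q) = hankel_integral \<rho> (hankel_kernel F w q)"
    by (intro hankel_integral_radius[of R]) auto
  thus ?thesis ..
qed

text \<open>For bounded \<open>F\<close> the circle of radius \<epsilon> contributes at most a
  constant times \<epsilon> and a power of its logarithm, which vanishes in the limit, while the two
  rays combine into one integral with the difference polynomial. Requiring the bound
  \<open>B\<close> for every \<epsilon> avoids any integral starting at 0.\<close>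

lemma hankel_integral_collapse:
  assumes F: "hankel_amplitude R F" and w: "w \<ge> 1" and \<rho>: "0 < \<rho>" "\<rho> < R"
    and bounded: "eventually (\<lambda>t. cmod (F t) \<le> M) (at 0)"
    and rays: "\<And>\<epsilon>. 0 < \<epsilon> \<Longrightarrow> cmod (integral {\<epsilon>..} (\<lambda>x. F (of_real x) *
      exp (- (of_real w * of_real x)) * poly (pcompose q [:2 * of_real pi * \<i>, 1:] - q) (of_real (ln x)))) \<le> B"
  shows "cmod (hankel_integral \<rho> (hankel_kernel F w q)) \<le> B"
proof -
  define \<tau> where "\<tau> = 2 * of_real pi * \<i>"
  define G where "G = hankel_kernel F w q"
  obtain C where C: "C > 0" "\<And>x. cmod (poly q x) \<le> C * (1 + cmod x) ^ degree q"
    using poly_growth[of q "degree q"] by blast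
  obtain \<delta> where \<delta>: "\<delta> > 0" "\<And>t. t \<noteq> 0 \<Longrightarrow> cmod t < \<delta> \<Longrightarrow> cmod (F t) \<le> M"
    using bounded by (auto simp: eventually_at dist_norm)
  \<comment> \<open>Length of the circle times bounds for the three factors:
    \<open>\<bar>M\<bar>\<close> for \<open>F\<close>, \<open>exp (w * \<epsilon>)\<close> since
    \<open>Re t \<ge> - \<epsilon>\<close>, and polynomial growth with
    \<open>cmod u \<le> \<bar>ln \<epsilon>\<bar> + 2 * pi\<close>.\<close>
  define A where "A = (\<lambda>\<epsilon>. \<bar>M\<bar> * C * (2 * pi) * (\<epsilon> * exp (w * \<epsilon>) * (1 + (\<bar>ln \<epsilon>\<bar> + 2 * pi)) ^ degree q))"
  have bound: "cmod (hankel_integral \<rho> G) \<le> A \<epsilon> + B" if \<epsilon>: "\<epsilon> > 0" "\<epsilon> \<le> \<rho>" "\<epsilon> < \<delta>" for \<epsilon>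
  proof -
    define c where "c = (\<lambda>\<theta>. G (of_real (ln \<epsilon>) + \<i> * of_real \<theta>) * (\<i> * of_real \<epsilon> * cis \<theta>))"
    define b where "b = \<bar>M\<bar> * exp (w * \<epsilon>) * (C * (1 + (\<bar>ln \<epsilon>\<bar> + 2 * pi)) ^ degree q) * \<epsilon>"
    have "cmod (c \<theta>) \<le> b" if \<theta>: "\<theta> \<in> {0..2 * pi}" for \<theta>
    proof -
      define u where "u = of_real (ln \<epsilon>) + \<i> * of_real \<theta>"
      have [simp]: "exp (Re u) = \<epsilon>"
        using \<epsilon> by (simp add: u_def)
      have "cmod (F (exp u)) \<le> M"
        using \<delta>(2)[of "exp u"] \<epsilon> by simp
      hence "cmod (F (exp u)) \<le> \<bar>M\<bar>"
        by linarith
      moreover have "\<bar>Re (exp u)\<bar> \<le> \<epsilon>"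
        using abs_Re_le_cmod[of "exp u"] by simp
      hence "- (w * Re (exp u)) \<le> w * \<epsilon>"
        using w mult_left_mono[of "- Re (exp u)" \<epsilon> w] by simp
      hence "cmod (exp (- (of_real w * exp u))) \<le> exp (w * \<epsilon>)"
        by simp
      moreover have "cmod u \<le> \<bar>ln \<epsilon>\<bar> + 2 * pi"
        unfolding u_def using \<theta> by (intro norm_triangle_le add_mono) (auto simp: norm_mult)
      hence "C * (1 + cmod u) ^ degree q \<le> C * (1 + (\<bar>ln \<epsilon>\<bar> + 2 * pi)) ^ degree q"
        using C(1) by (intro mult_left_mono power_mono) auto
      hence "cmod (poly q u) \<le> C * (1 + (\<bar>ln \<epsilon>\<bar> + 2 * pi)) ^ degree q"
        using C(2) order.trans by blast
      moreover have "cmod (c \<theta>) = cmod (F (exp u)) * cmod (exp (- (of_real w * exp u))) * cmod (poly q u) * \<epsilon>"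
        using \<epsilon> by (simp add: c_def G_def hankel_kernel_def u_def[symmetric] norm_mult)
      ultimately show ?thesis
        unfolding b_def using \<epsilon> by (auto intro!: mult_mono)
    qed
    moreover have "(\<lambda>_. b) integrable_on {0..2 * pi}"
      by (rule integrable_const_ivl)
    moreover have "c integrable_on {0..2 * pi}"
      unfolding c_def G_def using \<epsilon> \<rho> by (intro hankel_kernel_integrable(3)[OF F w]) auto
    ultimately have "cmod (integral {0..2 * pi} c) \<le> integral {0..2 * pi} (\<lambda>_. b)"
      by (intro integral_norm_bound_integral) auto
    hence circle: "cmod (integral {0..2 * pi} c) \<le> A \<epsilon>"
      by (simp add: b_def A_def mult_ac)
    have "integral {\<epsilon>..} (\<lambda>x. G (of_real (ln x) + \<tau>)) - integral {\<epsilon>..} (\<lambda>x. G (of_real (ln x))) =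
        integral {\<epsilon>..} (\<lambda>x. G (of_real (ln x) + \<tau>) - G (of_real (ln x)))"
      unfolding G_def \<tau>_def
      using hankel_kernel_integrable(1,2)[OF F w \<epsilon>(1)] by (intro integral_diff[symmetric])
    also have "\<dots> = integral {\<epsilon>..} (\<lambda>x. F (of_real x) * exp (- (of_real w * of_real x)) *
        poly (pcompose q [:\<tau>, 1:] - q) (of_real (ln x)))"
      unfolding G_def \<tau>_def using \<epsilon>
      by (intro integral_cong)
         (auto simp: hankel_kernel_lower hankel_kernel_upper right_diff_distrib)
    finally have "cmod (integral {\<epsilon>..} (\<lambda>x. G (of_real (ln x) + \<tau>)) - integral {\<epsilon>..} (\<lambda>x. G (of_real (ln x)))) \<le> B"
      using rays[OF \<epsilon>(1)] by (simp add: \<tau>_def)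
    moreover have "hankel_integral \<epsilon> G = integral {0..2 * pi} c +
        (integral {\<epsilon>..} (\<lambda>x. G (of_real (ln x) + \<tau>)) - integral {\<epsilon>..} (\<lambda>x. G (of_real (ln x))))"
      by (simp add: hankel_integral_def c_def \<tau>_def)
    ultimately have "cmod (hankel_integral \<epsilon> G) \<le> A \<epsilon> + B"
      using circle norm_triangle_mono by metis
    thus ?thesis
      using hankel_integral_radius[OF F w \<epsilon>(1,2) \<rho>(2), of q] by (simp add: G_def)
  qed
  have "((\<lambda>\<epsilon>. \<epsilon> * exp (w * \<epsilon>) * (1 + (\<bar>ln \<epsilon>\<bar> + 2 * pi)) ^ degree q) \<longlongrightarrow> 0) (at_right 0)"
    by real_asymp
  hence "((\<lambda>\<epsilon>. A \<epsilon> + B) \<longlongrightarrow> 0 + B) (at_right 0)"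
    unfolding A_def by (intro tendsto_add tendsto_mult_right_zero tendsto_const)
  moreover have "eventually (\<lambda>\<epsilon>. cmod (hankel_integral \<rho> G) \<le> A \<epsilon> + B) (at_right 0)"
    unfolding eventually_at_right_field using \<rho> \<delta>(1) bound
    by (intro exI[of _ "min \<rho> \<delta>"]) auto
  \<comment> \<open>The left-hand side does not depend on \<epsilon>, so the bound survives the
    limit.\<close>
  ultimately have "cmod (hankel_integral \<rho> G) \<le> 0 + B"
    by (intro tendsto_lowerbound) auto
  thus ?thesis
    by (simp add: G_def)
qed

section \<open>Application to the hypermultiple gamma functions\<close>

lemma hyper_gamma_BM_eq_hankel_kernel:
  assumes "\<And>x. Q0 m x = poly q x"
  shows "hyper_gamma_BM \<rho> m j (of_real w + a) \<omega> = hankel_integral \<rho>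
    (hankel_kernel (\<lambda>t. barnes_kernel \<omega> t * (exp (- a * t) * t powi (- j - 1))) w q)"
proof -
  \<comment> \<open>The shift \<open>a\<close> goes into the amplitude, which thus does not depend
    on \<open>w\<close>.\<close>
  have "exp (- (of_real w + a) * t) = exp (- a * t) * exp (- (of_real w * t))" for t
    by (simp add: exp_add [symmetric] algebra_simps)
  thus ?thesis
    unfolding hyper_gamma_BM_def hankel_kernel_def [abs_def] Let_def
    by (simp only: assms mult_ac)
qed

text \<open>Counting orders at 0, with \<open>r\<close> the length of \<omega>: the kernel has order
  \<open>- r\<close>, the power \<open>- k - 1\<close>, and the remainder after
  \<open>N = r + k\<close> at least \<open>r + k + 1\<close>. The product has order at least 0,
  hence a limit.\<close>

lemma bernoulli_remainder_bounded:
  assumes "0 \<notin> set \<omega>" "0 \<notin> set \<alpha>"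
  shows "\<exists>M. eventually (\<lambda>t. cmod (barnes_kernel \<omega> t * t powi (- int k - 1) *
    (exp (- a * t) * barnes_kernel \<alpha> t -
      (\<Sum>N = - int (length \<alpha>)..int (length \<omega>) + int k. multi_bernoulli N a \<alpha> * t powi N))) \<le> M) (at 0)"
    (is "\<exists>M. eventually (\<lambda>t. cmod (?f t) \<le> M) (at 0)")
proof -
  define I where "I = {- int (length \<alpha>)..int (length \<omega>) + int k}"
  from has_laurent_expansion_barnes_kernel[OF assms(1)] obtain F where F:
    "barnes_kernel \<omega> has_laurent_expansion F" "fls_subdegree F = - int (length \<omega>)" "F \<noteq> 0"
    by blast
  from multi_bernoulli_expansion[OF assms(2), of a] obtain L where L:
    "(\<lambda>t. exp (- a * t) * barnes_kernel \<alpha> t) has_laurent_expansion L"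
    "fls_subdegree L = - int (length \<alpha>)" "\<And>N. fls_nth L N = multi_bernoulli N a \<alpha>"
    by blast
  define T where "T = L - (\<Sum>N\<in>I. fls_const (multi_bernoulli N a \<alpha>) * fls_X_intpow N)"
  define M where "M = F * fls_X_intpow (- int k - 1) * T"
  have "?f has_laurent_expansion M"
    unfolding M_def T_def I_def by (intro laurent_expansion_intros F L)
  moreover have "fls_nth T n = 0" if "n \<le> int (length \<omega>) + int k" for n
  proof -
    have "fls_nth (\<Sum>N\<in>I. fls_const (multi_bernoulli N a \<alpha>) * fls_X_intpow N) n =
        (\<Sum>N\<in>I. if N = n then multi_bernoulli n a \<alpha> else 0)"
      unfolding fls_nth_sum by (intro sum.cong) auto
    also have "\<dots> = (if n \<in> I then multi_bernoulli n a \<alpha> else 0)"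
      by (simp add: I_def)
    \<comment> \<open>Below the range \<open>I\<close> both sides are 0, because \<open>L\<close>
      starts at its lower end.\<close>
    also have "\<dots> = fls_nth L n"
      using that L(2,3) by (auto simp: I_def L(3)[symmetric])
    finally show ?thesis
      by (simp add: T_def)
  qed
  \<comment> \<open>The zero series has subdegree 0 by convention, so it is treated apart.\<close>
  hence T: "fls_subdegree T > int (length \<omega>) + int k" if "T \<noteq> 0"
    using that by (intro fls_subdegree_greaterI) auto
  have "fls_subdegree M \<ge> 0"
  proof (cases "T = 0")
    case False
    have "F * fls_X_intpow (- int k - 1) \<noteq> 0"
      using F(3) by (simp add: fls_shift_eq0_iff)
    hence "fls_subdegree M = fls_subdegree F + (- int k - 1) + fls_subdegree T"
      unfolding M_def using False
      by (simp only: fls_subdegree_mult[OF _ False] fls_subdegree_mult_fls_X_intpow(2)[OF F(3)]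
          not_False_eq_True)
    thus ?thesis
      using F(2) T[OF False] by simp
  qed (simp add: M_def)
  ultimately have "?f \<midarrow>0\<rightarrow> fls_nth M 0"
    by (rule has_laurent_expansion_imp_tendsto_0)
  hence "((\<lambda>t. cmod (?f t)) \<longlongrightarrow> cmod (fls_nth M 0)) (at 0)"
    by (rule tendsto_norm)
  hence "eventually (\<lambda>t. cmod (?f t) < cmod (fls_nth M 0) + 1) (at 0)"
    by (rule order_tendstoD) simp
  hence "eventually (\<lambda>t. cmod (?f t) \<le> cmod (fls_nth M 0) + 1) (at 0)"
    by eventually_elim simp
  thus ?thesis
    by blast
qed

theorem theorem1p4:
  fixes r l m k :: nat and \<omega> \<alpha> :: "complex list" and a :: complex and \<rho> \<rho>' :: real
  assumes "r \<ge> 1" and "l \<ge> 1"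
    and "length \<omega> = r" and "length \<alpha> = l"
    and "\<forall>z\<in>set \<omega>. Re z > 0" and "\<forall>z\<in>set \<alpha>. Re z > 0" and "Re a > 0"
    and "admissible_radius (\<omega> @ \<alpha>) \<rho>" and "admissible_radius \<omega> \<rho>'"
  shows "(\<lambda>w::real. hyper_gamma_BM \<rho> m (int k) (of_real w + a) (\<omega> @ \<alpha>)
            - (\<Sum>N = - int l..int r + int k.
                 multi_bernoulli N a \<alpha> * hyper_gamma_BM \<rho>' m (int k - N) (of_real w) \<omega>))
         \<in> O[at_top](\<lambda>w. complex_of_real (ln w powi (int m - 1) / w))"
proof -
  define I where "I = {- int l..int r + int k}"
  define b where "b = (\<lambda>N. multi_bernoulli N a \<alpha>)"
  obtain q where q: "degree q \<le> m" "\<And>x. Q0 m x = poly q x"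
    using Q0_eq_poly by blast
  define d where "d = pcompose q [:2 * of_real pi * \<i>, 1:] - q"
  \<comment> \<open>The distance from the origin to the nearest other pole of the kernel;
    admissibility of \<rho> means \<open>0 < \<rho> < R\<close>.\<close>
  define R where "R = Min ((\<lambda>z. cmod (2 * of_real pi / z)) ` set (\<omega> @ \<alpha>))"
  define R' where "R' = Min ((\<lambda>z. cmod (2 * of_real pi / z)) ` set \<omega>)"
  have ne: "set \<omega> \<noteq> {}"
    using assms(1,3) by auto
  have R: "R \<le> cmod (2 * of_real pi / z)" if "z \<in> set (\<omega> @ \<alpha>)" for z
    unfolding R_def using that by (intro Min_le) auto
  have R': "R' \<le> cmod (2 * of_real pi / z)" if "z \<in> set \<omega>" for z
    unfolding R'_def using that by (intro Min_le) auto
  have \<rho>: "0 < \<rho>" "\<rho> < R" and \<rho>': "0 < \<rho>'" "\<rho>' < R'"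
    using assms(8,9) ne by (auto simp: admissible_radius_def R_def R'_def)
  have "R \<le> R'"
    unfolding R_def R'_def using ne by (intro Min_antimono) auto
  have zero: "0 \<notin> set \<omega>" "0 \<notin> set \<alpha>"
    using assms(5,6) by auto

  \<comment> \<open>The factor \<open>exp (- 0 * t)\<close> keeps the shape of the case
    \<open>a = 0\<close> of \<open>hyper_gamma_BM_eq_hankel_kernel\<close>.\<close>
  define F where "F = (\<lambda>N t. barnes_kernel \<omega> t * (exp (- 0 * t) * t powi (- (int k - N) - 1)))"
  define E where "E = (\<lambda>t. barnes_kernel (\<omega> @ \<alpha>) t * (exp (- a * t) * t powi (- int k - 1)))"
  define D where "D = (\<lambda>t. E t + (\<Sum>N\<in>I. - b N * F N t))"
  have F: "hankel_amplitude R (F N)" "hankel_amplitude R' (F N)" for N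
    unfolding F_def using assms(5) R R'
    by (intro hankel_amplitude_mult hankel_amplitude_barnes_kernel hankel_amplitude_exp
        hankel_amplitude_power_int; simp)+
  have E: "hankel_amplitude R E"
    unfolding E_def using assms(5-7) R
    by (intro hankel_amplitude_mult hankel_amplitude_barnes_kernel hankel_amplitude_exp
        hankel_amplitude_power_int) auto
  have F': "hankel_amplitude R (\<lambda>t. - b N * F N t)" for N
    by (intro hankel_amplitude_mult hankel_amplitude_const F)
  have D: "hankel_amplitude R D"
    unfolding D_def by (intro hankel_amplitude_add hankel_amplitude_sum E F')

  define \<Delta> where "\<Delta> = (\<lambda>w. hyper_gamma_BM \<rho> m (int k) (of_real w + a) (\<omega> @ \<alpha>)
    - (\<Sum>N\<in>I. b N * hyper_gamma_BM \<rho>' m (int k - N) (of_real w) \<omega>))"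
  have \<Delta>: "\<Delta> w = hankel_integral \<rho> (hankel_kernel D w q)" if w: "w \<ge> 1" for w
  proof -
    have "hankel_integral \<rho> (hankel_kernel D w q) = hankel_integral \<rho> (hankel_kernel E w q) +
        (\<Sum>N\<in>I. - b N * hankel_integral \<rho> (hankel_kernel (F N) w q))"
      unfolding D_def
      by (subst hankel_integral_add[OF E hankel_amplitude_sum[OF F'] w \<rho>],
          subst hankel_integral_sum[OF _ F' w \<rho>])
         (simp_all only: I_def hankel_integral_cmult finite_atLeastAtMost_int)
    moreover have "hankel_integral \<rho> (hankel_kernel E w q) =
        hyper_gamma_BM \<rho> m (int k) (of_real w + a) (\<omega> @ \<alpha>)"
      unfolding E_def by (rule hyper_gamma_BM_eq_hankel_kernel[OF q(2), symmetric])
    moreover have "hankel_integral \<rho> (hankel_kernel (F N) w q) =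
        hyper_gamma_BM \<rho>' m (int k - N) (of_real w) \<omega>" for N
    proof -
      \<comment> \<open>The radius \<rho>' is admissible for \<omega> alone and may exceed
        \<open>R\<close>, so the change of radius takes place in the larger disc of radius
        \<open>R'\<close>.\<close>
      have "hankel_integral \<rho> (hankel_kernel (F N) w q) = hankel_integral \<rho>' (hankel_kernel (F N) w q)"
        using \<rho> \<rho>' \<open>R \<le> R'\<close> by (intro hankel_integral_radius_eq[OF F(2) w]) auto
      thus ?thesis
        using hyper_gamma_BM_eq_hankel_kernel[OF q(2), where a = 0 and j = "int k - N"]
        by (simp add: F_def)
    qed
    ultimately show ?thesis
      by (simp add: \<Delta>_def sum_negf)
  qed

  have D_eq: "D t = barnes_kernel \<omega> t * t powi (- int k - 1) *
      (exp (- a * t) * barnes_kernel \<alpha> t - (\<Sum>N\<in>I. b N * t powi N))" if "t \<noteq> 0" for t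
  proof -
    have "t powi (- (int k - N) - 1) = t powi (- int k - 1) * t powi N" for N
      using that by (simp add: power_int_add[symmetric] algebra_simps)
    thus ?thesis
      by (simp add: D_def E_def F_def barnes_kernel_append sum_negf sum_distrib_left algebra_simps)
  qed
  obtain M where "eventually (\<lambda>t. cmod (barnes_kernel \<omega> t * t powi (- int k - 1) *
      (exp (- a * t) * barnes_kernel \<alpha> t - (\<Sum>N\<in>I. b N * t powi N))) \<le> M) (at 0)"
    using bernoulli_remainder_bounded[OF zero, of k a] assms(3,4) by (auto simp: I_def b_def)
  hence M: "eventually (\<lambda>t. cmod (D t) \<le> M) (at 0)"
    using eventually_neq_at_within[of 0] by eventually_elim (simp add: D_eq)
  then obtain \<delta> where \<delta>: "\<delta> > 0" "\<And>t. t \<noteq> 0 \<Longrightarrow> cmod t < \<delta> \<Longrightarrow> cmod (D t) \<le> M"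
    by (auto simp: eventually_at dist_norm)
  obtain C p where C: "C > 0" "\<And>x. x \<ge> \<delta> \<Longrightarrow> cmod (D (of_real x)) \<le> C * (1 + x) ^ p"
    using D slow_growthE[of D \<delta>] \<delta>(1) by (auto simp: hankel_amplitude_def)
  \<comment> \<open>Boundedness near 0 and slow growth from \<delta> onwards merge into one bound on
    the whole positive axis, as the uniformity in \<epsilon> demands.\<close>
  have growth: "cmod (D (of_real x)) \<le> max M C * (1 + x) ^ p" if "x > 0" for x
  proof -
    have "1 \<le> (1 + x) ^ p"
      using that by simp
    hence M_le: "M \<le> max M C * (1 + x) ^ p"
      using C(1) mult_mono[of M "max M C" 1 "(1 + x) ^ p"] by auto
    have C_le: "C * (1 + x) ^ p \<le> max M C * (1 + x) ^ p"
      using that by (intro mult_right_mono) auto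
    show ?thesis
    proof (cases "x < \<delta>")
      case True
      thus ?thesis
        using \<delta>(2)[of "of_real x"] M_le that by simp
    next
      case False
      thus ?thesis
        using order.trans[OF C(2) C_le] by simp
    qed
  qed
  have cont: "continuous_on {\<epsilon>..} (\<lambda>x. D (of_real x))" if "\<epsilon> > 0" for \<epsilon>
    using D that by (auto simp: hankel_amplitude_def intro: continuous_on_subset)

  have "\<Delta> \<in> O[at_top](\<lambda>w. complex_of_real (ln w powi (int m - 1) / w))"
  proof (cases m)
    \<comment> \<open>Here the exponent of the logarithm is -1. The polynomial is constant, its
      difference vanishes, and the collapse with bound 0 makes \<Delta> vanish identically for
      \<open>w \<ge> 1\<close>.\<close>
    case 0
    then obtain c where "q = [:c:]"
      using q(1) by (auto elim: degree_eq_zeroE)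
    hence "d = 0"
      by (simp add: d_def)
    hence "\<Delta> w = 0" if "w \<ge> 1" for w
      using hankel_integral_collapse[OF D that \<rho> M, of q 0] \<Delta>[OF that] by (simp add: d_def)
    hence "eventually (\<lambda>w. \<Delta> w = 0) at_top"
      unfolding eventually_at_top_linorder by blast
    from landau_o.big.in_cong[OF this] show ?thesis
      by simp
  next
    case (Suc n)
    have "degree d \<le> n"
      unfolding d_def using q(1) Suc by (intro degree_pcompose_shift_diff) simp
    then obtain K where K: "\<And>w \<epsilon>. w \<ge> 1 \<Longrightarrow> \<epsilon> > 0 \<Longrightarrow> cmod (integral {\<epsilon>..} (\<lambda>x. D (of_real x) *
        exp (- (of_real w * of_real x)) * poly d (of_real (ln x)))) \<le> K * (1 + ln w) ^ n / w"
    proof (rule ray_integral[where q = d and n = n and C = "max M C" and p = p])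
      fix K
      assume *: "\<And>w \<epsilon> F. w \<ge> 1 \<Longrightarrow> \<epsilon> > 0 \<Longrightarrow> continuous_on {\<epsilon>..} F \<Longrightarrow>
        (\<And>x. x \<ge> \<epsilon> \<Longrightarrow> cmod (F x) \<le> max M C * (1 + x) ^ p) \<Longrightarrow>
        (\<lambda>x. F x * exp (- (of_real w * of_real x)) * poly d (of_real (ln x))) integrable_on {\<epsilon>..} \<and>
        cmod (integral {\<epsilon>..} (\<lambda>x. F x * exp (- (of_real w * of_real x)) * poly d (of_real (ln x))))
          \<le> K * (1 + ln w) ^ n / w"
      show thesis
      proof (rule that)
        fix w \<epsilon> :: real assume "w \<ge> 1" "\<epsilon> > 0"
        thus "cmod (integral {\<epsilon>..} (\<lambda>x. D (of_real x) * exp (- (of_real w * of_real x)) *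
            poly d (of_real (ln x)))) \<le> K * (1 + ln w) ^ n / w"
          using *[of w \<epsilon> "\<lambda>x. D (of_real x)"] cont growth by auto
      qed
    qed
    \<comment> \<open>For \<open>w \<ge> exp 1\<close> one has
      \<open>1 + ln w \<le> 2 * ln w\<close>, whence the factor \<open>2 ^ n\<close>; the exponent
      \<open>int m - 1\<close> is \<open>n\<close>.\<close>
    have "eventually (\<lambda>w. norm (\<Delta> w) \<le> \<bar>K\<bar> * 2 ^ n * norm (complex_of_real (ln w powi (int m - 1) / w))) at_top"
      using eventually_ge_at_top[of "exp 1"]
    proof eventually_elim
      case (elim w)
      have w: "w \<ge> 1" "ln w \<ge> 1"
        using elim order.trans[OF _ elim, of 1] ln_ge_iff[of w 1] by (auto intro: less_le_trans[OF exp_gt_zero])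
      have "norm (\<Delta> w) \<le> K * (1 + ln w) ^ n / w"
        unfolding \<Delta>[OF w(1)] using K[OF w(1)]
        by (intro hankel_integral_collapse[OF D w(1) \<rho> M]) (simp add: d_def)
      also have "\<dots> \<le> \<bar>K\<bar> * (2 * ln w) ^ n / w"
        using w by (intro divide_right_mono mult_mono power_mono) auto
      also have "\<dots> = \<bar>K\<bar> * 2 ^ n * norm (complex_of_real (ln w powi (int m - 1) / w))"
        using w Suc by (simp add: power_mult_distrib norm_divide norm_power)
      finally show ?case .
    qed
    thus ?thesis
      by (rule bigoI)
  qed
  thus ?thesis
    by (simp only: \<Delta>_def I_def b_def)
qed

end
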